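(* Let $R$ be a ring and let $M$ be an endo-prime left $R$-module with $S=\mathrm{End}_R(M)$. Then: (1) If $M$ is $fi$-retractable, then $M$ is fully prime. (2) If $M$ is semi-injective, then the center of $S$ is a field. (3) If $M$ is pseudo-injective in $\sigma[M]$ and $\mathrm{Soc}(M)\neq 0$, then $M$ is polyform.
   Context: Rings are associative with non-zero identity, modules are unital and $M$ is non-zero. Endomorphisms of left modules are written on the right of their arguments, so in $S$ (and for compositions of homomorphisms in general) $fg$ means first $f$, then $g$. A submodule $K$ of $M$ is fully invariant if $(K)f\subseteq K$ for all $f\in S$. $M$ is endo-prime if for every non-zero fully invariant submodule $K$ of $M$, $\mathrm{Ann}_S(K)=\{f\in S\mid (K)f=0\}=0$. $M$ is $fi$-retractable if $\mathrm{Hom}_R(M,K)\neq 0$ for every non-zero fully invariant submodule $K$ of $M$. $M$ is fully prime if for every non-zero fully invariant submodule $K$ of $M$, $M$ is $K$-cogenerated (embeds in a direct product of copies of $K$). $M$ is semi-injective if for every $f\in S$, $fS=\{g\in S\mid (\mathrm{Ker} f)g=0\}$. $\sigma[M]$ is the full subcategory of left $R$-modules that are submodules of $M$-generated modules. A module $E$ is pseudo-injective in $\sigma[M]$ if for all monomorphisms $f:L\to N$ in $\sigma[M]$ and all non-zero homomorphisms $g:L\to E$ there exist $s\in\mathrm{End}_R(E)$ and $h:N\to E$ with $gs=fh\neq 0$. A submodule $U$ of a module $N$ is $M$-rational in $N$ if $\mathrm{Hom}_R(V/U,M)=0$ for all $U\subseteq V\subseteq N$; $M$ is polyform if every essential submodule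 of $M$ is $M$-rational in $M$. $\mathrm{Soc}(M)$ is the socle of $M$. *)

theory Defs
  imports "HOL-Algebra.Module" "HOL-Algebra.AbelCoset"
begin

text \<open>
  The locale \<open>module\<close> of HOL-Algebra requires a commutative ring of scalars. The records
  and the locale \<open>submodule\<close> do not, and are reused here. The fields \<open>mult\<close> and \<open>one\<close>
  of a module record are irrelevant, as in HOL-Algebra.
\<close>

locale left_module = R?: ring R + M?: abelian_group M
  for R :: "('r, 'q) ring_scheme" (structure) and M :: "('r, 'a, 'm) module_scheme" (structure) +
  assumes smult_closed [simp, intro]:
      "\<lbrakk>a \<in> carrier R; x \<in> carrier M\<rbrakk> \<Longrightarrow> a \<odot>\<^bsub>M\<^esub> x \<in> carrier M"
    and smult_l_distr:
      "\<lbrakk>a \<in> carrier R; b \<in> carrier R; x \<in> carrier M\<rbrakk> \<Longrightarrow>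
        (a \<oplus> b) \<odot>\<^bsub>M\<^esub> x = a \<odot>\<^bsub>M\<^esub> x \<oplus>\<^bsub>M\<^esub> b \<odot>\<^bsub>M\<^esub> x"
    and smult_r_distr:
      "\<lbrakk>a \<in> carrier R; x \<in> carrier M; y \<in> carrier M\<rbrakk> \<Longrightarrow>
        a \<odot>\<^bsub>M\<^esub> (x \<oplus>\<^bsub>M\<^esub> y) = a \<odot>\<^bsub>M\<^esub> x \<oplus>\<^bsub>M\<^esub> a \<odot>\<^bsub>M\<^esub> y"
    and smult_assoc1:
      "\<lbrakk>a \<in> carrier R; b \<in> carrier R; x \<in> carrier M\<rbrakk> \<Longrightarrow>
        (a \<otimes> b) \<odot>\<^bsub>M\<^esub> x = a \<odot>\<^bsub>M\<^esub> (b \<odot>\<^bsub>M\<^esub> x)"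
    and smult_one [simp]:
      "x \<in> carrier M \<Longrightarrow> \<one> \<odot>\<^bsub>M\<^esub> x = x"

text \<open>Homomorphisms are extensional functions, so that equality of homomorphisms is HOL equality.\<close>

definition lmod_hom ::
  "('r, 'q) ring_scheme \<Rightarrow> ('r, 'a, 'm) module_scheme \<Rightarrow> ('r, 'b, 'n) module_scheme \<Rightarrow> ('a \<Rightarrow> 'b) set"
  where "lmod_hom R M N =
    {f \<in> carrier M \<rightarrow>\<^sub>E carrier N.
       (\<forall>x \<in> carrier M. \<forall>y \<in> carrier M. f (x \<oplus>\<^bsub>M\<^esub> y) = f x \<oplus>\<^bsub>N\<^esub> f y) \<and>
       (\<forall>r \<in> carrier R. \<forall>x \<in> carrier M. f (r \<odot>\<^bsub>M\<^esub> x) = r \<odot>\<^bsub>N\<^esub> f x)}"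

definition lmod_zero_hom ::
  "('r, 'a, 'm) module_scheme \<Rightarrow> ('r, 'b, 'n) module_scheme \<Rightarrow> 'a \<Rightarrow> 'b"
  where "lmod_zero_hom M N = (\<lambda>x \<in> carrier M. \<zero>\<^bsub>N\<^esub>)"

text \<open>
  Homomorphisms of left modules are written on the right of their arguments, so a product
  \<open>f g\<close> means first \<open>f\<close>, then \<open>g\<close>; note the order of the arguments of \<open>compose\<close>,
  here and below.
\<close>

definition End_ring ::
  "('r, 'q) ring_scheme \<Rightarrow> ('r, 'a, 'm) module_scheme \<Rightarrow> ('a \<Rightarrow> 'a) ring"
  where "End_ring R M =
    \<lparr>carrier = lmod_hom R M M,
     mult = (\<lambda>f g. compose (carrier M) g f),
     one = (\<lambda>x \<in> carrier M. x),
     zero = lmod_zero_hom M M,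
     add = (\<lambda>f g. \<lambda>x \<in> carrier M. f x \<oplus>\<^bsub>M\<^esub> g x)\<rparr>"

definition ring_center :: "('s, 'q) ring_scheme \<Rightarrow> 's set"
  where "ring_center S = {z \<in> carrier S. \<forall>s \<in> carrier S. z \<otimes>\<^bsub>S\<^esub> s = s \<otimes>\<^bsub>S\<^esub> z}"

definition fully_invariant ::
  "('r, 'q) ring_scheme \<Rightarrow> ('r, 'a, 'm) module_scheme \<Rightarrow> 'a set \<Rightarrow> bool"
  where "fully_invariant R M K \<longleftrightarrow>
    submodule K R M \<and> (\<forall>f \<in> carrier (End_ring R M). f ` K \<subseteq> K)"

definition End_annihilator ::
  "('r, 'q) ring_scheme \<Rightarrow> ('r, 'a, 'm) module_scheme \<Rightarrow> 'a set \<Rightarrow> ('a \<Rightarrow> 'a) set"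
  where "End_annihilator R M K = {f \<in> carrier (End_ring R M). \<forall>x \<in> K. f x = \<zero>\<^bsub>M\<^esub>}"

definition endo_prime ::
  "('r, 'q) ring_scheme \<Rightarrow> ('r, 'a, 'm) module_scheme \<Rightarrow> bool"
  where "endo_prime R M \<longleftrightarrow>
    (\<forall>K. fully_invariant R M K \<and> K \<noteq> {\<zero>\<^bsub>M\<^esub>} \<longrightarrow>
       End_annihilator R M K = {\<zero>\<^bsub>End_ring R M\<^esub>})"

definition fi_retractable ::
  "('r, 'q) ring_scheme \<Rightarrow> ('r, 'a, 'm) module_scheme \<Rightarrow> bool"
  where "fi_retractable R M \<longleftrightarrow>
    (\<forall>K. fully_invariant R M K \<and> K \<noteq> {\<zero>\<^bsub>M\<^esub>} \<longrightarrow>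
       lmod_hom R M (M\<lparr>carrier := K\<rparr>) \<noteq> {lmod_zero_hom M (M\<lparr>carrier := K\<rparr>)})"

definition lmod_power ::
  "'i set \<Rightarrow> ('r, 'a, 'm) module_scheme \<Rightarrow> ('r, 'i \<Rightarrow> 'a) module"
  where "lmod_power I M =
    \<lparr>carrier = I \<rightarrow>\<^sub>E carrier M,
     mult = undefined,
     one = undefined,
     zero = (\<lambda>i \<in> I. \<zero>\<^bsub>M\<^esub>),
     add = (\<lambda>x y. \<lambda>i \<in> I. x i \<oplus>\<^bsub>M\<^esub> y i),
     smult = (\<lambda>r x. \<lambda>i \<in> I. r \<odot>\<^bsub>M\<^esub> x i)\<rparr>"

definition lmod_copower ::
  "'i set \<Rightarrow> ('r, 'a, 'm) module_scheme \<Rightarrow> ('r, 'i \<Rightarrow> 'a) module"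
  where "lmod_copower I M =
    (lmod_power I M)\<lparr>carrier := {x \<in> I \<rightarrow>\<^sub>E carrier M. finite {i \<in> I. x i \<noteq> \<zero>\<^bsub>M\<^esub>}}\<rparr>"

text \<open>
  \<open>N\<close> is \<open>K\<close>-cogenerated: it embeds in a direct product of copies of \<open>K\<close>. Index sets in the
  type \<open>'b \<Rightarrow> 'a\<close> are no restriction: the components of a homomorphism from \<open>N\<close> to a power
  of \<open>K\<close> are elements of \<open>Hom(N, K)\<close>, and repeated components can be dropped without
  changing the kernel.
\<close>

definition cogenerated_by ::
  "('r, 'q) ring_scheme \<Rightarrow> ('r, 'a, 'm) module_scheme \<Rightarrow> ('r, 'b, 'n) module_scheme \<Rightarrow> bool"
  where "cogenerated_by R K N \<longleftrightarrow>
    (\<exists>I :: ('b \<Rightarrow> 'a) set. \<exists>\<phi> \<in> lmod_hom R N (lmod_power I K). inj_on \<phi> (carrier N))"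

definition fully_prime ::
  "('r, 'q) ring_scheme \<Rightarrow> ('r, 'a, 'm) module_scheme \<Rightarrow> bool"
  where "fully_prime R M \<longleftrightarrow>
    (\<forall>K. fully_invariant R M K \<and> K \<noteq> {\<zero>\<^bsub>M\<^esub>} \<longrightarrow> cogenerated_by R (M\<lparr>carrier := K\<rparr>) M)"

definition semi_injective ::
  "('r, 'q) ring_scheme \<Rightarrow> ('r, 'a, 'm) module_scheme \<Rightarrow> bool"
  where "semi_injective R M \<longleftrightarrow>
    (\<forall>f \<in> carrier (End_ring R M).
       {f \<otimes>\<^bsub>End_ring R M\<^esub> s | s. s \<in> carrier (End_ring R M)} =
       {g \<in> carrier (End_ring R M). \<forall>x \<in> a_kernel M M f. g x = \<zero>\<^bsub>M\<^esub>})"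

text \<open>
  \<open>P\<close> is \<open>M\<close>-generated: it is a homomorphic image of a direct sum of copies of \<open>M\<close>. Index
  sets in the type \<open>'a \<Rightarrow> 'b\<close> are no restriction: the components of a homomorphism from a
  direct sum are elements of \<open>Hom(M, P)\<close>, and repeated components can be dropped without
  changing the image.
\<close>

definition generated_by ::
  "('r, 'q) ring_scheme \<Rightarrow> ('r, 'a, 'm) module_scheme \<Rightarrow> ('r, 'b, 'n) module_scheme \<Rightarrow> bool"
  where "generated_by R M P \<longleftrightarrow>
    left_module R P \<and>
    (\<exists>I :: ('a \<Rightarrow> 'b) set. \<exists>\<phi> \<in> lmod_hom R (lmod_copower I M) P.
       \<phi> ` carrier (lmod_copower I M) = carrier P)"

text \<open>
  The objects of \<open>\<sigma>[M]\<close>: modules isomorphic to a submodule of an \<open>M\<close>-generated module. HOL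
  cannot quantify over types, so a carrier type for the \<open>M\<close>-generated module \<open>P\<close> is fixed,
  large enough to be no restriction: let \<open>N\<close> be a submodule of an image of a direct sum of
  copies of \<open>M\<close>. Each element of \<open>N\<close> has a preimage of finite support, so the copies indexed
  by the union of these supports suffice. This union injects into \<open>'b \<times> nat\<close>, so \<open>P\<close> may be
  taken to be a quotient of a direct sum indexed by a set in \<open>'b \<times> nat\<close>, whose elements are
  cosets.
\<close>

definition in_sigma ::
  "('r, 'q) ring_scheme \<Rightarrow> ('r, 'a, 'm) module_scheme \<Rightarrow> ('r, 'b, 'n) module_scheme \<Rightarrow> bool"
  where "in_sigma R M N \<longleftrightarrow>
    left_module R N \<and>
    (\<exists>P :: ('r, ('b \<times> nat \<Rightarrow> 'a) set) module.
       generated_by R M P \<and> (\<exists>\<iota> \<in> lmod_hom R N P. inj_on \<iota> (carrier N)))"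

text \<open>
  \<open>E\<close> is pseudo-injective in \<open>\<sigma>[M]\<close>. Monomorphisms in \<open>\<sigma>[M]\<close> are the injective
  homomorphisms, because \<open>\<sigma>[M]\<close> is closed under submodules. The test modules \<open>L\<close> and \<open>N\<close>
  range over modules with carrier in the type \<open>'r \<Rightarrow> 'e \<times> nat\<close>, which is no restriction.
  Given any \<open>f\<close> and \<open>g\<close> as in the definition, pass to \<open>L / Ker g\<close> and \<open>N / (Ker g) f\<close>, and
  then factor out from the latter a submodule maximal with respect to having zero
  intersection with the image of the former. Homomorphisms \<open>s\<close> and \<open>h\<close> for the resulting
  test yield such homomorphisms for the original one. Now \<open>g\<close> is injective and \<open>N\<close> is an
  essential extension of \<open>L\<close>. If \<open>D\<close> is a divisible hull of the additive group of \<open>L\<close>, then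
  the left module of additive maps from \<open>R\<close> to \<open>D\<close> is injective and contains a copy of \<open>L\<close>,
  hence one of \<open>N\<close>; and \<open>D\<close> injects into \<open>'e \<times> nat\<close>. Both modules obtained are in \<open>\<sigma>[M]\<close>, as
  \<open>\<sigma>[M]\<close> is closed under quotients and isomorphic copies.
\<close>

definition pseudo_injective_in_sigma ::
  "('r, 'q) ring_scheme \<Rightarrow> ('r, 'a, 'm) module_scheme \<Rightarrow> ('r, 'e, 'n) module_scheme \<Rightarrow> bool"
  where "pseudo_injective_in_sigma R M E \<longleftrightarrow>
    (\<forall>(L :: ('r, 'r \<Rightarrow> 'e \<times> nat) module) (N :: ('r, 'r \<Rightarrow> 'e \<times> nat) module) f g.
       in_sigma R M L \<and> in_sigma R M N \<and>
       f \<in> lmod_hom R L N \<and> inj_on f (carrier L) \<and>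
       g \<in> lmod_hom R L E \<and> g \<noteq> lmod_zero_hom L E \<longrightarrow>
       (\<exists>s \<in> lmod_hom R E E. \<exists>h \<in> lmod_hom R N E.
          compose (carrier L) s g = compose (carrier L) h f \<and>
          compose (carrier L) h f \<noteq> lmod_zero_hom L E))"

definition lmod_quotient ::
  "('r, 'a, 'm) module_scheme \<Rightarrow> 'a set \<Rightarrow> ('r, 'a set) module"
  where "lmod_quotient V U =
    \<lparr>carrier = a_rcosets\<^bsub>V\<^esub> U,
     mult = undefined,
     one = undefined,
     zero = U,
     add = (\<lambda>X Y. X <+>\<^bsub>V\<^esub> Y),
     smult = (\<lambda>r X. \<Union>x \<in> X. U +>\<^bsub>V\<^esub> (r \<odot>\<^bsub>V\<^esub> x))\<rparr>"

definition essential_submodule ::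
  "('r, 'q) ring_scheme \<Rightarrow> ('r, 'a, 'm) module_scheme \<Rightarrow> 'a set \<Rightarrow> bool"
  where "essential_submodule R M U \<longleftrightarrow>
    submodule U R M \<and>
    (\<forall>K. submodule K R M \<and> K \<noteq> {\<zero>\<^bsub>M\<^esub>} \<longrightarrow> U \<inter> K \<noteq> {\<zero>\<^bsub>M\<^esub>})"

definition rational_in ::
  "('r, 'q) ring_scheme \<Rightarrow> ('r, 'a, 'm) module_scheme \<Rightarrow> 'b set \<Rightarrow> ('r, 'b, 'n) module_scheme \<Rightarrow> bool"
  where "rational_in R M U N \<longleftrightarrow>
    submodule U R N \<and>
    (\<forall>V. submodule V R N \<and> U \<subseteq> V \<longrightarrow>
       lmod_hom R (lmod_quotient (N\<lparr>carrier := V\<rparr>) U) M =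
       {lmod_zero_hom (lmod_quotient (N\<lparr>carrier := V\<rparr>) U) M})"

definition polyform ::
  "('r, 'q) ring_scheme \<Rightarrow> ('r, 'a, 'm) module_scheme \<Rightarrow> bool"
  where "polyform R M \<longleftrightarrow> (\<forall>U. essential_submodule R M U \<longrightarrow> rational_in R M U M)"

definition simple_submodule ::
  "('r, 'q) ring_scheme \<Rightarrow> ('r, 'a, 'm) module_scheme \<Rightarrow> 'a set \<Rightarrow> bool"
  where "simple_submodule R M K \<longleftrightarrow>
    submodule K R M \<and> K \<noteq> {\<zero>\<^bsub>M\<^esub>} \<and>
    (\<forall>H. submodule H R M \<and> H \<subseteq> K \<longrightarrow> H = {\<zero>\<^bsub>M\<^esub>} \<or> H = K)"

text \<open>The sum of all simple submodules, i.e. the submodule generated by their union.\<close>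

definition socle ::
  "('r, 'q) ring_scheme \<Rightarrow> ('r, 'a, 'm) module_scheme \<Rightarrow> 'a set"
  where "socle R M = \<Inter>{H. submodule H R M \<and> (\<forall>K. simple_submodule R M K \<longrightarrow> K \<subseteq> H)}"

end

theory Submission
  imports Defs "HOL-Algebra.Subrings"
begin

text \<open>
  In an endo-prime module a non-zero endomorphism kills no non-zero fully invariant submodule
  (\<open>endo_prime_faithful\<close>). Each of the three claims comes from a suitable fully invariant
  submodule together with an endomorphism that kills it.

  If \<open>K\<close> is fully invariant, then so is the intersection \<open>X\<close> of the kernels of all homomorphisms
  \<open>M \<rightarrow> K\<close>, because \<open>Hom(M, K)\<close> is stable under first applying an endomorphism of \<open>M\<close>. When
  \<open>M\<close> is \<open>fi\<close>-retractable and \<open>K\<close> is not zero, some non-zero \<open>f : M \<rightarrow> K\<close> exists, and, viewed as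
  an endomorphism of \<open>M\<close>, it kills \<open>X\<close>. So \<open>X\<close> is zero, which says that \<open>M\<close> embeds in the power
  \<open>K\<^sup>H\<close> with \<open>H = Hom(M, K)\<close>.

  If \<open>z\<close> is a non-zero central endomorphism, then \<open>Ker z\<close> is fully invariant and killed by \<open>z\<close>,
  hence zero. Semi-injectivity turns this into \<open>zS = S\<close>, so \<open>z\<close> is invertible in \<open>S\<close>, and the
  inverse of a central element is central.

  For the last claim the submodule is the intersection \<open>X\<close> of all essential submodules of \<open>M\<close>. It
  is fully invariant because preimages of essential submodules under endomorphisms are
  essential, and it contains the socle because an essential submodule meets, hence contains,
  every simple one. So \<open>X\<close> is non-zero if the socle is, and an endomorphism that vanishes on an
  essential submodule vanishes (\<open>end_zero_if_zero_on_essential\<close>). If \<open>M\<close> were not polyform, there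
  would be a non-zero \<open>g : V \<rightarrow> M\<close>, defined on a submodule \<open>V\<close>, that kills an essential
  submodule \<open>U \<subseteq> V\<close>. Pseudo-injectivity, used for the inclusion \<open>V \<rightarrow> M\<close>, gives an
  endomorphism \<open>h\<close> of \<open>M\<close> with \<open>gs = h\<close> on \<open>V\<close> and \<open>h \<noteq> 0\<close> there; but \<open>h\<close> kills \<open>U\<close>.
  As pseudo-injectivity is stated for test modules over one particular carrier type, \<open>V\<close> and
  \<open>M\<close> have to be copied into that type first (\<open>pseudo_injective_extension\<close>).
\<close>

section \<open>Homomorphisms and submodules of left modules\<close>

lemma lmod_homI:
  assumes "f \<in> carrier M \<rightarrow>\<^sub>E carrier N"
    and "\<And>x y. \<lbrakk>x \<in> carrier M; y \<in> carrier M\<rbrakk> \<Longrightarrow> f (x \<oplus>\<^bsub>M\<^esub> y) = f x \<oplus>\<^bsub>N\<^esub> f y"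
    and "\<And>r x. \<lbrakk>r \<in> carrier R; x \<in> carrier M\<rbrakk> \<Longrightarrow> f (r \<odot>\<^bsub>M\<^esub> x) = r \<odot>\<^bsub>N\<^esub> f x"
  shows "f \<in> lmod_hom R M N"
  using assms by (simp add: lmod_hom_def)

lemma lmod_homD:
  assumes "f \<in> lmod_hom R M N"
  shows lmod_hom_extensional: "f \<in> extensional (carrier M)"
    and lmod_hom_closed: "x \<in> carrier M \<Longrightarrow> f x \<in> carrier N"
    and lmod_hom_add: "\<lbrakk>x \<in> carrier M; y \<in> carrier M\<rbrakk> \<Longrightarrow> f (x \<oplus>\<^bsub>M\<^esub> y) = f x \<oplus>\<^bsub>N\<^esub> f y"
    and lmod_hom_smult: "\<lbrakk>r \<in> carrier R; x \<in> carrier M\<rbrakk> \<Longrightarrow> f (r \<odot>\<^bsub>M\<^esub> x) = r \<odot>\<^bsub>N\<^esub> f x"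
  using assms by (auto simp: lmod_hom_def PiE_iff)

lemma lmod_hom_compose:
  assumes "f \<in> lmod_hom R L M" "g \<in> lmod_hom R M N"
    and "\<And>x y. \<lbrakk>x \<in> carrier L; y \<in> carrier L\<rbrakk> \<Longrightarrow> x \<oplus>\<^bsub>L\<^esub> y \<in> carrier L"
    and "\<And>r x. \<lbrakk>r \<in> carrier R; x \<in> carrier L\<rbrakk> \<Longrightarrow> r \<odot>\<^bsub>L\<^esub> x \<in> carrier L"
  shows "compose (carrier L) g f \<in> lmod_hom R L N"
  by (rule lmod_homI)
    (auto simp: compose_def assms lmod_homD[OF assms(1)] lmod_homD[OF assms(2)])

context left_module
begin

lemma smult_l_null: "x \<in> carrier M \<Longrightarrow> \<zero>\<^bsub>R\<^esub> \<odot>\<^bsub>M\<^esub> x = \<zero>\<^bsub>M\<^esub>"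
  by (metis M.add.r_cancel_one' R.l_zero R.zero_closed smult_closed smult_l_distr)

lemma smult_r_null: "r \<in> carrier R \<Longrightarrow> r \<odot>\<^bsub>M\<^esub> \<zero>\<^bsub>M\<^esub> = \<zero>\<^bsub>M\<^esub>"
  by (metis M.add.r_cancel_one' M.l_zero M.zero_closed smult_closed smult_r_distr)

lemma smult_minus_one: "x \<in> carrier M \<Longrightarrow> (\<ominus>\<^bsub>R\<^esub> \<one>\<^bsub>R\<^esub>) \<odot>\<^bsub>M\<^esub> x = \<ominus>\<^bsub>M\<^esub> x"
  by (metis M.minus_equality R.add.inv_closed R.l_neg R.one_closed smult_closed smult_l_distr
      smult_l_null smult_one)

text \<open>Closure under negation comes from the scalar \<open>-1\<close>.\<close>

lemma submoduleI:
  assumes "H \<subseteq> carrier M" "\<zero>\<^bsub>M\<^esub> \<in> H"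
    and "\<And>x y. \<lbrakk>x \<in> H; y \<in> H\<rbrakk> \<Longrightarrow> x \<oplus>\<^bsub>M\<^esub> y \<in> H"
    and smult: "\<And>r x. \<lbrakk>r \<in> carrier R; x \<in> H\<rbrakk> \<Longrightarrow> r \<odot>\<^bsub>M\<^esub> x \<in> H"
  shows "submodule H R M"
proof -
  have "\<ominus>\<^bsub>M\<^esub> x \<in> H" if "x \<in> H" for x
    using smult[of "\<ominus>\<^bsub>R\<^esub> \<one>\<^bsub>R\<^esub>" x] smult_minus_one[of x] that assms(1) by auto
  then show ?thesis
    using assms by unfold_locales (auto simp: a_inv_def)
qed

lemma submoduleD:
  assumes "submodule H R M"
  shows submodule_subset: "H \<subseteq> carrier M"
    and submodule_mem: "x \<in> H \<Longrightarrow> x \<in> carrier M"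
    and submodule_zero: "\<zero>\<^bsub>M\<^esub> \<in> H"
    and submodule_add: "\<lbrakk>x \<in> H; y \<in> H\<rbrakk> \<Longrightarrow> x \<oplus>\<^bsub>M\<^esub> y \<in> H"
    and submodule_smult: "\<lbrakk>r \<in> carrier R; x \<in> H\<rbrakk> \<Longrightarrow> r \<odot>\<^bsub>M\<^esub> x \<in> H"
proof -
  interpret additive_subgroup H M
    using assms by (simp add: additive_subgroup_def submodule_def)
  show "H \<subseteq> carrier M" "x \<in> H \<Longrightarrow> x \<in> carrier M" "\<zero>\<^bsub>M\<^esub> \<in> H"
    "\<lbrakk>x \<in> H; y \<in> H\<rbrakk> \<Longrightarrow> x \<oplus>\<^bsub>M\<^esub> y \<in> H"
    using a_subset by auto
  show "\<lbrakk>r \<in> carrier R; x \<in> H\<rbrakk> \<Longrightarrow> r \<odot>\<^bsub>M\<^esub> x \<in> H"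
    using assms by (rule submodule.smult_closed)
qed

lemma submodule_left_module:
  assumes "submodule H R M"
  shows "left_module R (M\<lparr>carrier := H\<rparr>)"
proof (intro left_module.intro left_module_axioms.intro)
  interpret H: additive_subgroup H M
    using assms by (simp add: additive_subgroup_def submodule_def)
  show "abelian_group (M\<lparr>carrier := H\<rparr>)"
    using submoduleD[OF assms]
    by (intro abelian_groupI) (auto simp: M.a_assoc intro: M.a_comm intro!: bexI M.l_neg)
qed (use submoduleD[OF assms] R.ring_axioms in
  \<open>auto simp: smult_l_distr smult_r_distr smult_assoc1\<close>)

lemma lmod_hom_zero:
  assumes "f \<in> lmod_hom R M N" "left_module R N"
  shows "f \<zero>\<^bsub>M\<^esub> = \<zero>\<^bsub>N\<^esub>"
proof -
  interpret N: left_module R N by fact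
  show ?thesis
    using lmod_hom_add[OF assms(1), of "\<zero>\<^bsub>M\<^esub>" "\<zero>\<^bsub>M\<^esub>"] lmod_hom_closed[OF assms(1), of "\<zero>\<^bsub>M\<^esub>"]
    by simp
qed

lemma lmod_hom_minus:
  assumes "f \<in> lmod_hom R M N" "left_module R N" "x \<in> carrier M"
  shows "f (\<ominus>\<^bsub>M\<^esub> x) = \<ominus>\<^bsub>N\<^esub> f x"
proof -
  interpret N: left_module R N by fact
  show ?thesis
    using lmod_hom_smult[OF assms(1), of "\<ominus>\<^bsub>R\<^esub> \<one>\<^bsub>R\<^esub>" x] assms
    by (simp add: smult_minus_one N.smult_minus_one lmod_hom_closed)
qed

lemma lmod_zero_hom_in_hom:
  assumes "left_module R N"
  shows "lmod_zero_hom M N \<in> lmod_hom R M N"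
proof -
  interpret N: left_module R N by fact
  show ?thesis
    by (rule lmod_homI) (auto simp: lmod_zero_hom_def N.smult_r_null)
qed

lemma submodule_trivial: "submodule {\<zero>\<^bsub>M\<^esub>} R M"
  by (rule submoduleI) (auto simp: smult_r_null)

lemma submodule_carrier: "submodule (carrier M) R M"
  by (rule submoduleI) auto

lemma submodule_Inter:
  assumes "\<And>H. H \<in> A \<Longrightarrow> submodule H R M" "A \<noteq> {}"
  shows "submodule (\<Inter>A) R M"
proof -
  note H = submoduleD[OF assms(1)]
  show ?thesis
  proof (rule submoduleI)
    show "\<Inter>A \<subseteq> carrier M" using assms(2) H(1) by blast
    show "\<zero>\<^bsub>M\<^esub> \<in> \<Inter>A" using H(3) by simp
    show "x \<oplus>\<^bsub>M\<^esub> y \<in> \<Inter>A" if "x \<in> \<Inter>A" "y \<in> \<Inter>A" for x y using H(4) that by simp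
    show "r \<odot>\<^bsub>M\<^esub> x \<in> \<Inter>A" if "r \<in> carrier R" "x \<in> \<Inter>A" for r x using H(5) that by simp
  qed
qed

lemma submodule_preimage:
  assumes "f \<in> lmod_hom R M N" "left_module R N" "submodule K R N"
  shows "submodule {x \<in> carrier M. f x \<in> K} R M"
proof -
  interpret N: left_module R N by fact
  show ?thesis
    using N.submoduleD[OF assms(3)]
    by (intro submoduleI) (auto simp: lmod_homD[OF assms(1)] lmod_hom_zero[OF assms(1,2)])
qed

lemma submodule_image:
  assumes "f \<in> lmod_hom R M N" "left_module R N" "submodule K R M"
  shows "submodule (f ` K) R N"
proof -
  interpret N: left_module R N by fact
  note f = lmod_homD[OF assms(1)] and K = submoduleD[OF assms(3)]
  show ?thesis
  proof (rule N.submoduleI)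
    show "f ` K \<subseteq> carrier N" using f K by auto
    show "\<zero>\<^bsub>N\<^esub> \<in> f ` K" using K(3) lmod_hom_zero[OF assms(1,2)] by force
  next
    fix x y assume "x \<in> f ` K" "y \<in> f ` K"
    then obtain a b where ab: "a \<in> K" "b \<in> K" "x = f a" "y = f b" by auto
    then have "x \<oplus>\<^bsub>N\<^esub> y = f (a \<oplus>\<^bsub>M\<^esub> b)" using f K by auto
    then show "x \<oplus>\<^bsub>N\<^esub> y \<in> f ` K" using ab K by auto
  next
    fix r x assume r: "r \<in> carrier R" and "x \<in> f ` K"
    then obtain a where a: "a \<in> K" "x = f a" by auto
    then have "r \<odot>\<^bsub>N\<^esub> x = f (r \<odot>\<^bsub>M\<^esub> a)" using f K r by auto
    then show "r \<odot>\<^bsub>N\<^esub> x \<in> f ` K" using a r K by auto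
  qed
qed

lemma lmod_hom_diff:
  assumes "f \<in> lmod_hom R M N" "left_module R N" "x \<in> carrier M" "y \<in> carrier M"
  shows "f (x \<ominus>\<^bsub>M\<^esub> y) = f x \<ominus>\<^bsub>N\<^esub> f y"
  using assms by (simp add: a_minus_def lmod_hom_add lmod_hom_minus)

section \<open>Common kernels of homomorphisms into a fully invariant submodule\<close>

lemma fully_invariantI:
  assumes "submodule K R M" "\<And>s x. \<lbrakk>s \<in> lmod_hom R M M; x \<in> K\<rbrakk> \<Longrightarrow> s x \<in> K"
  shows "fully_invariant R M K"
  using assms by (auto simp: fully_invariant_def End_ring_def)

lemma endo_prime_faithful:
  assumes "endo_prime R M" "fully_invariant R M K" "K \<noteq> {\<zero>\<^bsub>M\<^esub>}"
    and "f \<in> lmod_hom R M M" "\<And>x. x \<in> K \<Longrightarrow> f x = \<zero>\<^bsub>M\<^esub>"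
  shows "f = lmod_zero_hom M M"
proof -
  have "f \<in> End_annihilator R M K"
    using assms(4,5) by (simp add: End_annihilator_def End_ring_def)
  then show ?thesis
    using assms(1-3) by (auto simp: endo_prime_def End_ring_def)
qed

text \<open>
  If \<open>f : M \<rightarrow> N\<close> and \<open>s\<close> is an endomorphism of \<open>M\<close>, then \<open>sf\<close> is again a homomorphism to \<open>N\<close>; an
  element killed by all homomorphisms to \<open>N\<close> is therefore moved by \<open>s\<close> to an element that they
  all kill.
\<close>

lemma common_kernel_fully_invariant:
  assumes "left_module R N"
  shows "fully_invariant R M {x \<in> carrier M. \<forall>f \<in> lmod_hom R M N. f x = \<zero>\<^bsub>N\<^esub>}"
proof (rule fully_invariantI)
  interpret N: left_module R N by fact
  have "{x \<in> carrier M. \<forall>f \<in> lmod_hom R M N. f x = \<zero>\<^bsub>N\<^esub>} =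
      \<Inter>((\<lambda>f. {x \<in> carrier M. f x \<in> {\<zero>\<^bsub>N\<^esub>}}) ` lmod_hom R M N)"
    using lmod_zero_hom_in_hom[OF assms] by auto
  moreover have "submodule (\<Inter>((\<lambda>f. {x \<in> carrier M. f x \<in> {\<zero>\<^bsub>N\<^esub>}}) ` lmod_hom R M N)) R M"
    using submodule_preimage[OF _ assms N.submodule_trivial] lmod_zero_hom_in_hom[OF assms]
    by (intro submodule_Inter) auto
  ultimately show "submodule {x \<in> carrier M. \<forall>f \<in> lmod_hom R M N. f x = \<zero>\<^bsub>N\<^esub>} R M"
    by simp
next
  fix s x assume s: "s \<in> lmod_hom R M M"
    and x: "x \<in> {x \<in> carrier M. \<forall>f \<in> lmod_hom R M N. f x = \<zero>\<^bsub>N\<^esub>}"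
  have "f (s x) = \<zero>\<^bsub>N\<^esub>" if f: "f \<in> lmod_hom R M N" for f
  proof -
    have "compose (carrier M) f s \<in> lmod_hom R M N"
      using s f by (rule lmod_hom_compose) auto
    then have "compose (carrier M) f s x = \<zero>\<^bsub>N\<^esub>" using x by auto
    then show ?thesis using x by (simp add: compose_def)
  qed
  then show "s x \<in> {x \<in> carrier M. \<forall>f \<in> lmod_hom R M N. f x = \<zero>\<^bsub>N\<^esub>}"
    using x lmod_hom_closed[OF s] by simp
qed

text \<open>
  The embedding is the canonical map of \<open>M\<close> to the power of \<open>N\<close> whose components are all the
  homomorphisms \<open>M \<rightarrow> N\<close>.
\<close>

lemma cogenerated_by_if_common_kernel_trivial:
  fixes N :: "('r, 'd, 'n) module_scheme"
  assumes N: "left_module R N"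
    and triv: "{x \<in> carrier M. \<forall>f \<in> lmod_hom R M N. f x = \<zero>\<^bsub>N\<^esub>} \<subseteq> {\<zero>\<^bsub>M\<^esub>}"
  shows "cogenerated_by R N M"
proof -
  interpret N: left_module R N by fact
  define H where "H = lmod_hom R M N"
  define \<phi> where "\<phi> = (\<lambda>x \<in> carrier M. \<lambda>f \<in> H. f x)"
  have "\<phi> \<in> lmod_hom R M (lmod_power H N)"
    by (rule lmod_homI)
      (auto simp: \<phi>_def lmod_power_def H_def lmod_hom_closed lmod_hom_add lmod_hom_smult
        intro!: restrict_ext)
  moreover have "inj_on \<phi> (carrier M)"
  proof (rule inj_onI)
    fix x y assume xy: "x \<in> carrier M" "y \<in> carrier M" and eq: "\<phi> x = \<phi> y"
    have "f (x \<ominus>\<^bsub>M\<^esub> y) = \<zero>\<^bsub>N\<^esub>" if "f \<in> H" for f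
    proof -
      have "f x = f y"
        using fun_cong[OF eq, of f] xy that by (simp add: \<phi>_def)
      then show ?thesis
        using that xy lmod_hom_diff[of f N x y] N lmod_hom_closed[of f R M N y]
        by (simp add: H_def N.r_neg N.minus_eq)
    qed
    then have "x \<ominus>\<^bsub>M\<^esub> y = \<zero>\<^bsub>M\<^esub>" using triv xy unfolding H_def by auto
    then show "x = y" using xy M.minus_equality[of x "\<ominus>\<^bsub>M\<^esub> y"] by (simp add: M.minus_eq)
  qed
  ultimately show ?thesis
    by (auto simp: cogenerated_by_def)
qed

text \<open>
  The common kernel of \<open>Hom(M, K)\<close> is killed by each of the homomorphisms that define it, one of
  which is a non-zero endomorphism of \<open>M\<close>.
\<close>

theorem fully_prime_if_fi_retractable:
  assumes ep: "endo_prime R M" and fi: "fi_retractable R M"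
  shows "fully_prime R M"
  unfolding fully_prime_def
proof (intro allI impI, elim conjE)
  fix K assume K: "fully_invariant R M K" "K \<noteq> {\<zero>\<^bsub>M\<^esub>}"
  let ?N = "M\<lparr>carrier := K\<rparr>"
  let ?X = "{x \<in> carrier M. \<forall>f \<in> lmod_hom R M ?N. f x = \<zero>\<^bsub>?N\<^esub>}"
  have sub: "submodule K R M" using K by (simp add: fully_invariant_def)
  note N = submodule_left_module[OF sub]
  obtain f where f: "f \<in> lmod_hom R M ?N" "f \<noteq> lmod_zero_hom M ?N"
    using fi K lmod_zero_hom_in_hom[OF N] unfolding fi_retractable_def by blast
  have f_end: "f \<in> lmod_hom R M M"
    using f(1) submodule_subset[OF sub] by (auto simp: lmod_hom_def PiE_iff)
  have "?X = {\<zero>\<^bsub>M\<^esub>}"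
  proof (rule ccontr)
    assume "?X \<noteq> {\<zero>\<^bsub>M\<^esub>}"
    with ep common_kernel_fully_invariant[OF N] have "f = lmod_zero_hom M M"
      by (rule endo_prime_faithful) (use f(1) f_end in auto)
    with f(2) show False by (simp add: lmod_zero_hom_def)
  qed
  then show "cogenerated_by R ?N M"
    by (intro cogenerated_by_if_common_kernel_trivial N) auto
qed

section \<open>The centre of the endomorphism ring\<close>

lemma End_ring_ring: "ring (End_ring R M)"
proof (rule ringI)
  show "abelian_group (End_ring R M)"
  proof (rule abelian_groupI)
    fix f g assume "f \<in> carrier (End_ring R M)" "g \<in> carrier (End_ring R M)"
    then show "f \<oplus>\<^bsub>End_ring R M\<^esub> g \<in> carrier (End_ring R M)"
      by (auto intro!: lmod_homI simp: End_ring_def lmod_homD smult_r_distr M.a_ac)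
  next
    fix f assume f: "f \<in> carrier (End_ring R M)"
    then have f': "f \<in> lmod_hom R M M" by (simp add: End_ring_def)
    have "(\<lambda>x \<in> carrier M. \<ominus>\<^bsub>M\<^esub> f x) \<in> lmod_hom R M M"
    proof (rule lmod_homI)
      fix r x assume "r \<in> carrier R" "x \<in> carrier M"
      then show "(\<lambda>x\<in>carrier M. \<ominus>\<^bsub>M\<^esub> f x) (r \<odot>\<^bsub>M\<^esub> x) = r \<odot>\<^bsub>M\<^esub> (\<lambda>x\<in>carrier M. \<ominus>\<^bsub>M\<^esub> f x) x"
        using lmod_hom_smult[OF f', of r "\<ominus>\<^bsub>M\<^esub> x"] lmod_hom_minus[OF f' left_module_axioms]
          M.minus_equality[of "r \<odot>\<^bsub>M\<^esub> \<ominus>\<^bsub>M\<^esub> f x" "r \<odot>\<^bsub>M\<^esub> f x"]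
          smult_r_distr[of r "\<ominus>\<^bsub>M\<^esub> f x" "f x"]
        by (simp add: lmod_homD[OF f'] M.l_neg smult_r_null)
    qed (auto simp: lmod_homD[OF f'] M.minus_add)
    then show "\<exists>g \<in> carrier (End_ring R M). g \<oplus>\<^bsub>End_ring R M\<^esub> f = \<zero>\<^bsub>End_ring R M\<^esub>"
      by (intro bexI[of _ "\<lambda>x \<in> carrier M. \<ominus>\<^bsub>M\<^esub> f x"])
        (auto simp: End_ring_def lmod_zero_hom_def lmod_homD[OF f'] M.l_neg)
  next
    fix f assume "f \<in> carrier (End_ring R M)"
    then have f: "f \<in> lmod_hom R M M" by (simp add: End_ring_def)
    show "\<zero>\<^bsub>End_ring R M\<^esub> \<oplus>\<^bsub>End_ring R M\<^esub> f = f"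
      by (rule extensionalityI[OF _ lmod_hom_extensional[OF f]])
        (simp_all add: End_ring_def lmod_zero_hom_def lmod_hom_closed[OF f])
  qed (auto simp: End_ring_def lmod_zero_hom_in_hom[OF left_module_axioms] lmod_hom_closed
      intro!: restrict_ext M.a_assoc M.a_comm)
  show "monoid (End_ring R M)"
  proof (rule monoidI)
    fix f assume "f \<in> carrier (End_ring R M)"
    then have f: "f \<in> lmod_hom R M M" by (simp add: End_ring_def)
    show "\<one>\<^bsub>End_ring R M\<^esub> \<otimes>\<^bsub>End_ring R M\<^esub> f = f" "f \<otimes>\<^bsub>End_ring R M\<^esub> \<one>\<^bsub>End_ring R M\<^esub> = f"
      by (rule extensionalityI[OF _ lmod_hom_extensional[OF f]];
          simp add: End_ring_def compose_def lmod_hom_closed[OF f])+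
  next
    show "\<one>\<^bsub>End_ring R M\<^esub> \<in> carrier (End_ring R M)"
      by (auto simp: End_ring_def intro!: lmod_homI)
    fix f g assume "f \<in> carrier (End_ring R M)" "g \<in> carrier (End_ring R M)"
    then show "f \<otimes>\<^bsub>End_ring R M\<^esub> g \<in> carrier (End_ring R M)"
      using lmod_hom_compose[of f R M M g M] by (simp add: End_ring_def)
  qed (auto simp: End_ring_def lmod_hom_closed compose_def intro!: restrict_ext)
qed (auto simp: End_ring_def lmod_hom_closed lmod_hom_add compose_def intro!: restrict_ext)

text \<open>If \<open>xz = 0\<close>, then \<open>(xs)z = (xz)s = 0\<close> for every endomorphism \<open>s\<close>.\<close>

lemma ker_fully_invariant_if_central:
  assumes "z \<in> ring_center (End_ring R M)"
  shows "fully_invariant R M {x \<in> carrier M. z x = \<zero>\<^bsub>M\<^esub>}"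
proof (rule fully_invariantI)
  have z: "z \<in> lmod_hom R M M"
    using assms by (simp add: ring_center_def End_ring_def)
  show "submodule {x \<in> carrier M. z x = \<zero>\<^bsub>M\<^esub>} R M"
    using submodule_preimage[OF z left_module_axioms submodule_trivial] by simp
  fix s x assume s: "s \<in> lmod_hom R M M" and x: "x \<in> {x \<in> carrier M. z x = \<zero>\<^bsub>M\<^esub>}"
  have "compose (carrier M) s z = compose (carrier M) z s"
    using assms s by (simp add: ring_center_def End_ring_def)
  from fun_cong[OF this, of x] have "z (s x) = s (z x)"
    using x by (simp add: compose_def)
  then show "s x \<in> {x \<in> carrier M. z x = \<zero>\<^bsub>M\<^esub>}"
    using x lmod_hom_closed[OF s] lmod_hom_zero[OF s left_module_axioms] by simp
qed

text \<open>
  The kernel of \<open>z\<close> is fully invariant and annihilated by \<open>z\<close>, so it vanishes. Then every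
  endomorphism kills \<open>Ker z\<close>, and semi-injectivity gives \<open>zS = S\<close>.
\<close>

lemma central_right_invertible:
  assumes "endo_prime R M" "semi_injective R M"
    and z: "z \<in> ring_center (End_ring R M)" "z \<noteq> \<zero>\<^bsub>End_ring R M\<^esub>"
  shows "\<exists>s \<in> carrier (End_ring R M). z \<otimes>\<^bsub>End_ring R M\<^esub> s = \<one>\<^bsub>End_ring R M\<^esub>"
proof -
  interpret S: ring "End_ring R M" by (rule End_ring_ring)
  have zS: "z \<in> carrier (End_ring R M)" using z by (simp add: ring_center_def)
  then have zhom: "z \<in> lmod_hom R M M" by (simp add: End_ring_def)
  let ?K = "{x \<in> carrier M. z x = \<zero>\<^bsub>M\<^esub>}"
  have K0: "?K = {\<zero>\<^bsub>M\<^esub>}"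
  proof (rule ccontr)
    assume "?K \<noteq> {\<zero>\<^bsub>M\<^esub>}"
    with assms(1) ker_fully_invariant_if_central[OF z(1)] have "z = lmod_zero_hom M M"
      by (rule endo_prime_faithful) (use zhom in auto)
    with z(2) show False by (simp add: End_ring_def)
  qed
  have "a_kernel M M z = ?K" by (simp add: a_kernel_def kernel_def)
  then have "\<one>\<^bsub>End_ring R M\<^esub> \<in>
      {g \<in> carrier (End_ring R M). \<forall>x \<in> a_kernel M M z. g x = \<zero>\<^bsub>M\<^esub>}"
    using K0 S.one_closed by (simp add: End_ring_def)
  also have "\<dots> = {z \<otimes>\<^bsub>End_ring R M\<^esub> s | s. s \<in> carrier (End_ring R M)}"
    using assms(2) zS by (simp add: semi_injective_def)
  finally show ?thesis by force
qed

end

lemma (in ring) ring_centerI: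
  assumes "z \<in> carrier R" "\<And>t. t \<in> carrier R \<Longrightarrow> z \<otimes> t = t \<otimes> z"
  shows "z \<in> ring_center R"
  using assms by (simp add: ring_center_def)

lemma (in ring) ring_center_carrier: "z \<in> ring_center R \<Longrightarrow> z \<in> carrier R"
  by (simp add: ring_center_def)

lemma (in ring) ring_center_comm:
  "\<lbrakk>z \<in> ring_center R; t \<in> carrier R\<rbrakk> \<Longrightarrow> z \<otimes> t = t \<otimes> z"
  by (simp add: ring_center_def)

lemma (in ring) center_subcring: "subcring (ring_center R) R"
proof (rule subcringI)
  show "subring (ring_center R) R"
  proof (rule subringI)
    show "ring_center R \<subseteq> carrier R" using ring_center_carrier by blast
    show "\<one> \<in> ring_center R" by (rule ring_centerI) auto
    fix x y assume xy: "x \<in> ring_center R" "y \<in> ring_center R"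
    note c = ring_center_carrier[OF xy(1)] ring_center_carrier[OF xy(2)]
    show "\<ominus> x \<in> ring_center R"
      by (rule ring_centerI) (simp_all add: c l_minus r_minus ring_center_comm[OF xy(1)])
    show "x \<oplus> y \<in> ring_center R"
      by (rule ring_centerI)
        (simp_all add: c l_distr r_distr ring_center_comm[OF xy(1)] ring_center_comm[OF xy(2)])
    have "x \<otimes> y \<otimes> t = t \<otimes> (x \<otimes> y)" if t: "t \<in> carrier R" for t
      using m_assoc[of x y t] m_assoc[of x t y] m_assoc[of t x y] t c
        ring_center_comm[OF xy(1) t] ring_center_comm[OF xy(2) t] by simp
    then show "x \<otimes> y \<in> ring_center R" using c by (intro ring_centerI) auto
  qed
next
  show "x \<otimes> y = y \<otimes> x" if "x \<in> ring_center R" "y \<in> ring_center R" for x y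
    using that by (intro ring_center_comm ring_center_carrier)
qed

lemma (in ring) center_inverse:
  assumes z: "z \<in> ring_center R" and s: "s \<in> carrier R" and zs: "z \<otimes> s = \<one>"
  shows "s \<in> ring_center R"
proof -
  note zc = ring_center_carrier[OF z] and comm = ring_center_comm[OF z]
  have "s \<otimes> t = t \<otimes> s" if t: "t \<in> carrier R" for t
  proof -
    have "s \<otimes> t = s \<otimes> (t \<otimes> (z \<otimes> s))" using zs s t by simp
    also have "\<dots> = (s \<otimes> z) \<otimes> (t \<otimes> s)" using comm s t zc by (metis m_assoc m_closed)
    also have "\<dots> = t \<otimes> s" using comm[OF s] zs s t by (metis l_one m_closed)
    finally show ?thesis .
  qed
  then show ?thesis using s by (intro ring_centerI)
qed

text \<open>
  By \<open>center_inverse\<close> it is enough to invert central elements in the whole ring.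
\<close>

lemma (in ring) center_field:
  assumes "\<one> \<noteq> \<zero>"
    and "\<And>z. \<lbrakk>z \<in> ring_center R; z \<noteq> \<zero>\<rbrakk> \<Longrightarrow> \<exists>s \<in> carrier R. z \<otimes> s = \<one>"
  shows "field (R\<lparr>carrier := ring_center R\<rparr>)"
proof -
  have sub: "ring_center R \<subseteq> carrier R" by (auto simp: ring_center_def)
  interpret Z: cring "R\<lparr>carrier := ring_center R\<rparr>"
    using center_subcring sub by (simp add: subcring_iff)
  show ?thesis
  proof (rule Z.cring_fieldI2)
    fix z assume "z \<in> carrier (R\<lparr>carrier := ring_center R\<rparr>)" "z \<noteq> \<zero>\<^bsub>R\<lparr>carrier := ring_center R\<rparr>\<^esub>"
    then show "\<exists>s \<in> carrier (R\<lparr>carrier := ring_center R\<rparr>).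
        z \<otimes>\<^bsub>R\<lparr>carrier := ring_center R\<rparr>\<^esub> s = \<one>\<^bsub>R\<lparr>carrier := ring_center R\<rparr>\<^esub>"
      using assms(2)[of z] center_inverse[of z] by auto
  qed (use assms(1) in auto)
qed

theorem (in left_module) center_field_if_semi_injective:
  assumes "carrier M \<noteq> {\<zero>\<^bsub>M\<^esub>}" "endo_prime R M" "semi_injective R M"
  shows "field ((End_ring R M)\<lparr>carrier := ring_center (End_ring R M)\<rparr>)"
proof (rule ring.center_field[OF End_ring_ring])
  obtain x where "x \<in> carrier M" "x \<noteq> \<zero>\<^bsub>M\<^esub>" using assms(1) M.zero_closed by blast
  then show "\<one>\<^bsub>End_ring R M\<^esub> \<noteq> \<zero>\<^bsub>End_ring R M\<^esub>"
    by (auto simp: End_ring_def lmod_zero_hom_def fun_eq_iff restrict_def)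
qed (rule central_right_invertible[OF assms(2,3)])


section \<open>Essential submodules\<close>

context left_module
begin

text \<open>
  A non-zero submodule \<open>K\<close> either lies in the kernel of \<open>f\<close>, hence in the preimage of \<open>E\<close>, or has a
  non-zero image, which meets \<open>E\<close>.
\<close>

lemma essential_preimage:
  assumes f: "f \<in> lmod_hom R M M" and E: "essential_submodule R M E"
  shows "essential_submodule R M {x \<in> carrier M. f x \<in> E}"
  unfolding essential_submodule_def
proof (intro conjI allI impI)
  have subE: "submodule E R M" using E by (simp add: essential_submodule_def)
  show "submodule {x \<in> carrier M. f x \<in> E} R M"
    by (rule submodule_preimage[OF f left_module_axioms subE])
  fix K assume "submodule K R M \<and> K \<noteq> {\<zero>\<^bsub>M\<^esub>}"
  then have K: "submodule K R M" "K \<noteq> {\<zero>\<^bsub>M\<^esub>}" by simp_all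
  have "\<exists>x \<in> K. f x \<in> E \<and> x \<noteq> \<zero>\<^bsub>M\<^esub>"
  proof (cases "f ` K = {\<zero>\<^bsub>M\<^esub>}")
    case True
    obtain x where x: "x \<in> K" "x \<noteq> \<zero>\<^bsub>M\<^esub>" using K submodule_zero[OF K(1)] by blast
    moreover have "f x = \<zero>\<^bsub>M\<^esub>" using True x(1) by blast
    ultimately show ?thesis using submodule_zero[OF subE] by (intro bexI[of _ x]) simp_all
  next
    case False
    have "E \<inter> f ` K \<noteq> {\<zero>\<^bsub>M\<^esub>}" "\<zero>\<^bsub>M\<^esub> \<in> E \<inter> f ` K"
      using E False submodule_image[OF f left_module_axioms K(1)]
        submodule_zero[OF submodule_image[OF f left_module_axioms K(1)]] submodule_zero[OF subE]
      by (auto simp: essential_submodule_def)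
    then obtain y where "y \<in> E" "y \<in> f ` K" "y \<noteq> \<zero>\<^bsub>M\<^esub>" by blast
    then show ?thesis using lmod_hom_zero[OF f left_module_axioms] by auto
  qed
  then show "{x \<in> carrier M. f x \<in> E} \<inter> K \<noteq> {\<zero>\<^bsub>M\<^esub>}"
    using submodule_mem[OF K(1)] by blast
qed

lemma essential_carrier: "essential_submodule R M (carrier M)"
  using submodule_carrier submodule_subset by (auto simp: essential_submodule_def Int_absorb1)

lemma Inter_essential_fully_invariant:
  "fully_invariant R M (\<Inter>{E. essential_submodule R M E})"
proof (rule fully_invariantI)
  show "submodule (\<Inter>{E. essential_submodule R M E}) R M"
    using essential_carrier by (intro submodule_Inter) (auto simp: essential_submodule_def)
qed (use essential_preimage in blast)

text \<open>
  The intersection of \<open>E\<close> with a simple submodule is a non-zero submodule of it, hence all of it.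
\<close>

lemma socle_subset_essential:
  assumes E: "essential_submodule R M E"
  shows "socle R M \<subseteq> E"
proof -
  have subE: "submodule E R M" using E by (simp add: essential_submodule_def)
  have "K \<subseteq> E" if K: "simple_submodule R M K" for K
  proof -
    have subK: "submodule K R M" "K \<noteq> {\<zero>\<^bsub>M\<^esub>}" using K by (simp_all add: simple_submodule_def)
    have "submodule (\<Inter>{E, K}) R M" using subE subK by (intro submodule_Inter) auto
    moreover have "E \<inter> K \<noteq> {\<zero>\<^bsub>M\<^esub>}" using E subK by (simp add: essential_submodule_def)
    ultimately have "E \<inter> K = K" using K by (auto simp: simple_submodule_def)
    then show ?thesis by blast
  qed
  then show ?thesis using subE by (auto simp: socle_def)
qed

text \<open>
  The intersection of all essential submodules is contained in \<open>U\<close> and contains the non-zero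
  socle, so endo-primeness applies to it.
\<close>

lemma end_zero_if_zero_on_essential:
  assumes ep: "endo_prime R M" and soc: "socle R M \<noteq> {\<zero>\<^bsub>M\<^esub>}"
    and U: "essential_submodule R M U"
    and h: "h \<in> lmod_hom R M M" "\<And>x. x \<in> U \<Longrightarrow> h x = \<zero>\<^bsub>M\<^esub>"
  shows "h = lmod_zero_hom M M"
proof (rule endo_prime_faithful[OF ep Inter_essential_fully_invariant _ h(1)])
  have "\<zero>\<^bsub>M\<^esub> \<in> socle R M" by (auto simp: socle_def submodule_zero)
  then have "\<not> socle R M \<subseteq> {\<zero>\<^bsub>M\<^esub>}" using soc by blast
  then show "\<Inter>{E. essential_submodule R M E} \<noteq> {\<zero>\<^bsub>M\<^esub>}"
    using socle_subset_essential by blast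
qed (use U h(2) in blast)

end

section \<open>Transport of modules along injections\<close>

text \<open>
  The copy of \<open>M\<close> on the image of its carrier under \<open>e\<close>, meant for \<open>e\<close> injective on the whole type.
  It moves a module to a prescribed carrier type.
\<close>

definition transport_module :: "('a \<Rightarrow> 'b) \<Rightarrow> ('r, 'a, 'm) module_scheme \<Rightarrow> ('r, 'b) module"
  where "transport_module e M =
    \<lparr>carrier = e ` carrier M,
     mult = undefined,
     one = undefined,
     zero = e \<zero>\<^bsub>M\<^esub>,
     add = (\<lambda>x y. e (the_inv e x \<oplus>\<^bsub>M\<^esub> the_inv e y)),
     smult = (\<lambda>r x. e (r \<odot>\<^bsub>M\<^esub> the_inv e x))\<rparr>"

lemma transport_module_simps:
  assumes "inj e"
  shows "carrier (transport_module e M) = e ` carrier M"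
    and "\<zero>\<^bsub>transport_module e M\<^esub> = e \<zero>\<^bsub>M\<^esub>"
    and "e x \<oplus>\<^bsub>transport_module e M\<^esub> e y = e (x \<oplus>\<^bsub>M\<^esub> y)"
    and "r \<odot>\<^bsub>transport_module e M\<^esub> e x = e (r \<odot>\<^bsub>M\<^esub> x)"
  using assms by (simp_all add: transport_module_def the_inv_f_f)

context left_module
begin

lemma transport_left_module:
  fixes e :: "'a \<Rightarrow> 'd"
  assumes e: "inj e"
  shows "left_module R (transport_module e M)"
proof (intro left_module.intro left_module_axioms.intro R.ring_axioms)
  show "abelian_group (transport_module e M)"
  proof (rule abelian_groupI)
    fix x assume "x \<in> carrier (transport_module e M)"
    then obtain a where a: "a \<in> carrier M" "x = e a" by (auto simp: transport_module_simps[OF e])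
    show "\<exists>y \<in> carrier (transport_module e M).
        y \<oplus>\<^bsub>transport_module e M\<^esub> x = \<zero>\<^bsub>transport_module e M\<^esub>"
      using a by (intro bexI[of _ "e (\<ominus>\<^bsub>M\<^esub> a)"])
        (auto simp: transport_module_simps[OF e] M.l_neg)
  qed (auto simp: transport_module_simps[OF e] M.a_ac)
qed (auto simp: transport_module_simps[OF e] smult_l_distr smult_r_distr smult_assoc1)

text \<open>One copy of \<open>M\<close> suffices, so the index set is a singleton.\<close>

lemma generated_by_transport:
  fixes e :: "'a \<Rightarrow> 'd"
  assumes e: "inj e"
  shows "generated_by R M (transport_module e M)"
  unfolding generated_by_def
proof (intro conjI transport_left_module e)
  define I :: "('a \<Rightarrow> 'd) set" where "I = {undefined}"
  define i :: "'a \<Rightarrow> 'd" where "i = undefined"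
  define \<phi> where "\<phi> = (\<lambda>x \<in> carrier (lmod_copower I M). e (x i))"
  have carr: "carrier (lmod_copower I M) = I \<rightarrow>\<^sub>E carrier M"
    by (simp add: lmod_copower_def I_def)
  have i: "i \<in> I" by (simp add: I_def i_def)
  have "\<phi> \<in> lmod_hom R (lmod_copower I M) (transport_module e M)"
    by (rule lmod_homI)
      (use i in \<open>auto simp: \<phi>_def carr transport_module_simps[OF e] PiE_mem,
         auto simp: lmod_copower_def lmod_power_def PiE_iff transport_module_simps[OF e]\<close>)
  moreover have "\<phi> ` carrier (lmod_copower I M) = carrier (transport_module e M)"
  proof
    show "\<phi> ` carrier (lmod_copower I M) \<subseteq> carrier (transport_module e M)"
      using i by (auto simp: \<phi>_def carr transport_module_simps[OF e] PiE_mem)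
    show "carrier (transport_module e M) \<subseteq> \<phi> ` carrier (lmod_copower I M)"
    proof
      fix y assume "y \<in> carrier (transport_module e M)"
      then obtain a where "a \<in> carrier M" "y = e a" by (auto simp: transport_module_simps[OF e])
      then show "y \<in> \<phi> ` carrier (lmod_copower I M)"
        using i by (intro image_eqI[of _ _ "\<lambda>j \<in> I. a"]) (auto simp: \<phi>_def carr)
    qed
  qed
  ultimately show "\<exists>I :: ('a \<Rightarrow> 'd) set. \<exists>\<phi> \<in> lmod_hom R (lmod_copower I M) (transport_module e M).
      \<phi> ` carrier (lmod_copower I M) = carrier (transport_module e M)"
    by blast
qed

text \<open>
  A submodule of \<open>M\<close> embeds in \<open>M\<close>, which is itself \<open>M\<close>-generated; the ambient module is a copy
  of \<open>M\<close> on the carrier type that \<open>in_sigma\<close> prescribes.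
\<close>

lemma in_sigma_transport:
  fixes e :: "'a \<Rightarrow> 'd"
  assumes e: "inj e" and V: "submodule V R M"
  shows "in_sigma R M (transport_module e (M\<lparr>carrier := V\<rparr>))"
  unfolding in_sigma_def
proof (intro conjI exI)
  let ?N = "transport_module e (M\<lparr>carrier := V\<rparr>)"
  interpret V: left_module R "M\<lparr>carrier := V\<rparr>" by (rule submodule_left_module[OF V])
  show "left_module R ?N" by (rule V.transport_left_module[OF e])
  \<comment> \<open>Any injection into this type would do.\<close>
  define e' :: "'a \<Rightarrow> ('d \<times> nat \<Rightarrow> 'a) set" where "e' a = {\<lambda>_. a}" for a
  have e': "inj e'" by (auto simp: inj_def e'_def fun_eq_iff)
  show "generated_by R M (transport_module e' M)" by (rule generated_by_transport[OF e'])
  define \<iota> where "\<iota> = (\<lambda>x \<in> e ` V. e' (the_inv e x))"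
  have "\<iota> \<in> lmod_hom R ?N (transport_module e' M)"
    using submodule_mem[OF V] submodule_add[OF V] submodule_smult[OF V] e
    by (intro lmod_homI) (auto simp: the_inv_f_f[OF e] inj_eq[OF e] \<iota>_def transport_module_simps[OF e] transport_module_simps[OF e'])
  moreover have "inj_on \<iota> (carrier ?N)"
    by (intro inj_onI)
      (auto simp: the_inv_f_f[OF e] \<iota>_def transport_module_simps[OF e] inj_eq[OF e'])
  ultimately show "\<exists>\<iota> \<in> lmod_hom R ?N (transport_module e' M). inj_on \<iota> (carrier ?N)" by blast
qed

text \<open>
  This is the defining property for the inclusion \<open>V \<rightarrow> M\<close>, where \<open>V\<close> and \<open>M\<close> need not live in the
  carrier type of the test modules: both are copied there along one injection \<open>e\<close>, and the
  homomorphism obtained on the copy of \<open>M\<close> is pulled back along \<open>e\<close>.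
\<close>

lemma pseudo_injective_extension:
  assumes pinj: "pseudo_injective_in_sigma R M M" and V: "submodule V R M"
    and g: "g \<in> lmod_hom R (M\<lparr>carrier := V\<rparr>) M" "g \<noteq> lmod_zero_hom (M\<lparr>carrier := V\<rparr>) M"
  shows "\<exists>s \<in> lmod_hom R M M. \<exists>h \<in> lmod_hom R M M.
    (\<forall>x \<in> V. s (g x) = h x) \<and> (\<exists>x \<in> V. h x \<noteq> \<zero>\<^bsub>M\<^esub>)"
proof -
  define e :: "'a \<Rightarrow> 'r \<Rightarrow> 'a \<times> nat" where "e a = (\<lambda>_. (a, 0))" for a
  have e: "inj e" by (auto simp: inj_def e_def fun_eq_iff)
  note tr = transport_module_simps[OF e]
  let ?L = "transport_module e (M\<lparr>carrier := V\<rparr>)" and ?N = "transport_module e M"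
  note Vmem = submodule_mem[OF V] and Vcl = submodule_add[OF V] submodule_smult[OF V]
  have N: "in_sigma R M ?N"
    using in_sigma_transport[OF e submodule_carrier] by (simp add: transport_module_def)
  define f where "f = (\<lambda>x \<in> e ` V. x)"
  define g' where "g' = (\<lambda>x \<in> e ` V. g (the_inv e x))"
  have f: "f \<in> lmod_hom R ?L ?N" "inj_on f (carrier ?L)"
    using Vmem Vcl by (auto intro!: lmod_homI inj_onI simp: f_def tr)
  have g': "g' \<in> lmod_hom R ?L M"
    using Vcl e lmod_homD[OF g(1)] by (intro lmod_homI) (auto simp: the_inv_f_f[OF e] inj_eq[OF e] g'_def tr)
  have "g' \<noteq> lmod_zero_hom ?L M"
  proof
    assume eq: "g' = lmod_zero_hom ?L M"
    have "g x = \<zero>\<^bsub>M\<^esub>" if "x \<in> V" for x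
      using fun_cong[OF eq, of "e x"] that e by (simp add: the_inv_f_f g'_def lmod_zero_hom_def tr)
    then have "g = lmod_zero_hom (M\<lparr>carrier := V\<rparr>) M"
      using lmod_hom_extensional[OF g(1)]
      by (intro extensionalityI[of _ V]) (auto simp: lmod_zero_hom_def)
    with g(2) show False ..
  qed
  then obtain s h' where s: "s \<in> lmod_hom R M M" and h': "h' \<in> lmod_hom R ?N M"
    and eq: "compose (carrier ?L) s g' = compose (carrier ?L) h' f"
    and ne: "compose (carrier ?L) h' f \<noteq> lmod_zero_hom ?L M"
    using pinj in_sigma_transport[OF e V] N f g' unfolding pseudo_injective_in_sigma_def by meson
  define h where "h = (\<lambda>x \<in> carrier M. h' (e x))"
  have h: "h \<in> lmod_hom R M M"
  proof (rule lmod_homI)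
    show "h \<in> carrier M \<rightarrow>\<^sub>E carrier M" using lmod_hom_closed[OF h'] by (auto simp: h_def tr)
    show "h (x \<oplus>\<^bsub>M\<^esub> y) = h x \<oplus>\<^bsub>M\<^esub> h y" if "x \<in> carrier M" "y \<in> carrier M" for x y
      using lmod_hom_add[OF h', of "e x" "e y"] that by (simp add: h_def tr)
    show "h (r \<odot>\<^bsub>M\<^esub> x) = r \<odot>\<^bsub>M\<^esub> h x" if "r \<in> carrier R" "x \<in> carrier M" for r x
      using lmod_hom_smult[OF h', of r "e x"] that by (simp add: h_def tr)
  qed
  have sg: "s (g x) = h x" if "x \<in> V" for x
    using fun_cong[OF eq, of "e x"] that e Vmem
    by (simp add: the_inv_f_f compose_def tr f_def g'_def h_def)
  have "\<exists>x \<in> V. h x \<noteq> \<zero>\<^bsub>M\<^esub>"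
  proof (rule ccontr)
    assume "\<not> (\<exists>x \<in> V. h x \<noteq> \<zero>\<^bsub>M\<^esub>)"
    then have "compose (carrier ?L) h' f = lmod_zero_hom ?L M"
      using Vmem by (auto simp: compose_def lmod_zero_hom_def tr f_def h_def intro!: restrict_ext)
    with ne show False ..
  qed
  with s h sg show ?thesis by blast
qed

end

section \<open>Polyform modules\<close>

context left_module
begin

lemma lmod_quotient_carrier:
  "carrier (lmod_quotient M U) = (\<lambda>v. U +>\<^bsub>M\<^esub> v) ` carrier M"
  by (simp add: lmod_quotient_def A_RCOSETS_def' UNION_singleton_eq_range)

lemma lmod_quotient_map_hom:
  assumes U: "submodule U R M"
  shows "(\<lambda>v \<in> carrier M. U +>\<^bsub>M\<^esub> v) \<in> lmod_hom R M (lmod_quotient M U)"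
proof (rule lmod_homI)
  interpret U: abelian_subgroup U M
    using U M.abelian_group_axioms
    by (intro abelian_subgroupI3) (simp_all add: additive_subgroup_def submodule_def)
  show "(\<lambda>v\<in>carrier M. U +>\<^bsub>M\<^esub> v) \<in> carrier M \<rightarrow>\<^sub>E carrier (lmod_quotient M U)"
    by (auto simp: lmod_quotient_carrier)
  show "(\<lambda>v\<in>carrier M. U +>\<^bsub>M\<^esub> v) (x \<oplus>\<^bsub>M\<^esub> y) =
      (\<lambda>v\<in>carrier M. U +>\<^bsub>M\<^esub> v) x \<oplus>\<^bsub>lmod_quotient M U\<^esub> (\<lambda>v\<in>carrier M. U +>\<^bsub>M\<^esub> v) y"
    if "x \<in> carrier M" "y \<in> carrier M" for x y
    using that U.a_rcos_sum by (simp add: lmod_quotient_def)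
  show "(\<lambda>v\<in>carrier M. U +>\<^bsub>M\<^esub> v) (r \<odot>\<^bsub>M\<^esub> x) =
      r \<odot>\<^bsub>lmod_quotient M U\<^esub> (\<lambda>v\<in>carrier M. U +>\<^bsub>M\<^esub> v) x"
    if r: "r \<in> carrier R" and x: "x \<in> carrier M" for r x
  proof -
    \<comment> \<open>The scalar multiple of a coset is defined as a union over its elements, all of whose terms
       coincide.\<close>
    have "U +>\<^bsub>M\<^esub> (r \<odot>\<^bsub>M\<^esub> y) = U +>\<^bsub>M\<^esub> (r \<odot>\<^bsub>M\<^esub> x)" if y: "y \<in> U +>\<^bsub>M\<^esub> x" for y
    proof -
      obtain u where u: "u \<in> U" "y = u \<oplus>\<^bsub>M\<^esub> x" using y by (auto simp: a_r_coset_def')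
      then have "r \<odot>\<^bsub>M\<^esub> y = r \<odot>\<^bsub>M\<^esub> u \<oplus>\<^bsub>M\<^esub> r \<odot>\<^bsub>M\<^esub> x"
        using r x submodule_mem[OF U] by (simp add: smult_r_distr)
      then have "r \<odot>\<^bsub>M\<^esub> y \<in> U +>\<^bsub>M\<^esub> (r \<odot>\<^bsub>M\<^esub> x)"
        using submodule_smult[OF U r u(1)] by (auto simp: a_r_coset_def')
      then show ?thesis
        using M.a_repr_independence[OF _ _ U.a_subgroup] r x by simp
    qed
    moreover have "x \<in> U +>\<^bsub>M\<^esub> x" using U.a_rcos_self[OF x] .
    ultimately have "(\<Union>y \<in> U +>\<^bsub>M\<^esub> x. U +>\<^bsub>M\<^esub> (r \<odot>\<^bsub>M\<^esub> y)) = U +>\<^bsub>M\<^esub> (r \<odot>\<^bsub>M\<^esub> x)" by blast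
    then show ?thesis using r x by (simp add: lmod_quotient_def)
  qed
qed

text \<open>
  Homomorphisms out of \<open>M/U\<close> are the homomorphisms out of \<open>M\<close> that vanish on \<open>U\<close>; this is the
  half of the correspondence that detects their vanishing.
\<close>

lemma hom_quotient_trivialI:
  assumes U: "submodule U R M" and N: "left_module R N"
    and triv: "\<And>g. \<lbrakk>g \<in> lmod_hom R M N; \<And>u. u \<in> U \<Longrightarrow> g u = \<zero>\<^bsub>N\<^esub>\<rbrakk> \<Longrightarrow> g = lmod_zero_hom M N"
  shows "lmod_hom R (lmod_quotient M U) N = {lmod_zero_hom (lmod_quotient M U) N}"
proof (intro equalityI subsetI)
  interpret N: left_module R N by fact
  let ?Q = "lmod_quotient M U"
  let ?q = "\<lambda>v \<in> carrier M. U +>\<^bsub>M\<^esub> v"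
  note q = lmod_quotient_map_hom[OF U]
  have Q: "carrier ?Q = ?q ` carrier M" by (simp add: lmod_quotient_carrier)
  show "k \<in> {lmod_zero_hom ?Q N}" if k: "k \<in> lmod_hom R ?Q N" for k
  proof -
    have U0: "U +>\<^bsub>M\<^esub> u = U +>\<^bsub>M\<^esub> \<zero>\<^bsub>M\<^esub>" if "u \<in> U" for u
      using that U submodule_mem[OF U] submodule_zero[OF U] M.a_coset_join2[of _ U]
      by (simp add: submodule_def)
    let ?g = "compose (carrier M) k ?q"
    have g: "?g \<in> lmod_hom R M N" by (rule lmod_hom_compose[OF q k]) auto
    have "?g u = \<zero>\<^bsub>N\<^esub>" if u: "u \<in> U" for u
    proof -
      have "?g u = ?g \<zero>\<^bsub>M\<^esub>" using U0[OF u] submodule_mem[OF U u] by (simp add: compose_def)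
      then show ?thesis using lmod_hom_zero[OF g N] by simp
    qed
    then have g0: "?g = lmod_zero_hom M N" by (rule triv[OF g])
    have "k (?q v) = \<zero>\<^bsub>N\<^esub>" if "v \<in> carrier M" for v
      using that fun_cong[OF g0, of v] by (simp add: compose_def lmod_zero_hom_def)
    then have "k = lmod_zero_hom ?Q N"
      using lmod_hom_extensional[OF k]
      by (intro extensionalityI[of _ "carrier ?Q"]) (auto simp: Q lmod_zero_hom_def)
    then show ?thesis by simp
  qed
  \<comment> \<open>A homomorphism is undefined off its domain, so that even the zero map respects the operations
     of \<open>M/U\<close> only because these do not lead out of the set of cosets.\<close>
  show "k \<in> lmod_hom R ?Q N" if k: "k \<in> {lmod_zero_hom ?Q N}" for k
  proof -
    have "x \<oplus>\<^bsub>?Q\<^esub> y \<in> carrier ?Q" if xy: "x \<in> carrier ?Q" "y \<in> carrier ?Q" for x y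
    proof -
      obtain v w where vw: "v \<in> carrier M" "w \<in> carrier M" "x = ?q v" "y = ?q w"
        using xy unfolding Q by blast
      have "?q (v \<oplus>\<^bsub>M\<^esub> w) \<in> carrier ?Q" by (rule lmod_hom_closed[OF q]) (use vw in simp)
      then show ?thesis unfolding vw(3,4) lmod_hom_add[OF q vw(1,2)] .
    qed
    moreover have "r \<odot>\<^bsub>?Q\<^esub> x \<in> carrier ?Q" if r: "r \<in> carrier R" and x: "x \<in> carrier ?Q" for r x
    proof -
      obtain v where v: "v \<in> carrier M" "x = ?q v" using x unfolding Q by blast
      have "?q (r \<odot>\<^bsub>M\<^esub> v) \<in> carrier ?Q" by (rule lmod_hom_closed[OF q]) (use r v in simp)
      then show ?thesis unfolding v(2) lmod_hom_smult[OF q r v(1)] .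
    qed
    ultimately show ?thesis
      using k by (auto intro!: lmod_homI simp: lmod_zero_hom_def N.smult_r_null)
  qed
qed

text \<open>
  Let \<open>g : V \<rightarrow> M\<close> kill \<open>U\<close>. If \<open>g\<close> is not zero, then \<open>gs\<close> extends to an endomorphism \<open>h \<noteq> 0\<close> of
  \<open>M\<close> for some endomorphism \<open>s\<close>; but \<open>h\<close> still kills the essential submodule \<open>U\<close>.
\<close>

theorem polyform_if_pseudo_injective:
  assumes ep: "endo_prime R M" and pinj: "pseudo_injective_in_sigma R M M"
    and soc: "socle R M \<noteq> {\<zero>\<^bsub>M\<^esub>}"
  shows "polyform R M"
  unfolding polyform_def rational_in_def
proof (intro allI impI conjI)
  fix U assume U: "essential_submodule R M U"
  then show subU: "submodule U R M" by (simp add: essential_submodule_def)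
  fix V assume "submodule V R M \<and> U \<subseteq> V"
  then have V: "submodule V R M" and UV: "U \<subseteq> V" by simp_all
  let ?V = "M\<lparr>carrier := V\<rparr>"
  interpret V: left_module R ?V by (rule submodule_left_module[OF V])
  show "lmod_hom R (lmod_quotient ?V U) M = {lmod_zero_hom (lmod_quotient ?V U) M}"
  proof (rule V.hom_quotient_trivialI[OF _ left_module_axioms])
    show "submodule U R ?V"
      using submoduleD[OF subU] UV by (intro V.submoduleI) auto
    fix g assume g: "g \<in> lmod_hom R ?V M" and gU: "\<And>u. u \<in> U \<Longrightarrow> g u = \<zero>\<^bsub>M\<^esub>"
    show "g = lmod_zero_hom ?V M"
    proof (rule ccontr)
      assume "g \<noteq> lmod_zero_hom ?V M"
      then obtain s h where s: "s \<in> lmod_hom R M M" and h: "h \<in> lmod_hom R M M"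
        and sg: "\<And>x. x \<in> V \<Longrightarrow> s (g x) = h x" and ne: "\<exists>x \<in> V. h x \<noteq> \<zero>\<^bsub>M\<^esub>"
        using pseudo_injective_extension[OF pinj V g] by blast
      have "h x = \<zero>\<^bsub>M\<^esub>" if "x \<in> U" for x
        using sg[of x] that UV gU lmod_hom_zero[OF s left_module_axioms] by auto
      with ep soc U h have "h = lmod_zero_hom M M" by (rule end_zero_if_zero_on_essential)
      with ne submodule_mem[OF V] show False by (auto simp: lmod_zero_hom_def)
    qed
  qed
qed

end

theorem proposition2p2:
  fixes R :: "('r, 'q) ring_scheme" and M :: "('r, 'a, 'm) module_scheme"
  assumes "left_module R M"
    and "\<one>\<^bsub>R\<^esub> \<noteq> \<zero>\<^bsub>R\<^esub>"
    and "carrier M \<noteq> {\<zero>\<^bsub>M\<^esub>}"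
    and "endo_prime R M"
  shows "(fi_retractable R M \<longrightarrow> fully_prime R M) \<and>
    (semi_injective R M \<longrightarrow>
       field ((End_ring R M)\<lparr>carrier := ring_center (End_ring R M)\<rparr>)) \<and>
    (pseudo_injective_in_sigma R M M \<and> socle R M \<noteq> {\<zero>\<^bsub>M\<^esub>} \<longrightarrow> polyform R M)"
proof -
  interpret left_module R M by fact
  show ?thesis
    using assms fully_prime_if_fi_retractable center_field_if_semi_injective
      polyform_if_pseudo_injective by blast
qed

end
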